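(* Let $\mathcal S\subset\mathbb{S}^{d-1}$ be a geodesically convex set, and let $f:\mathcal S\to\mathbb{R}$ be differentiable and $\nu$-strongly geodesically convex on $\mathcal S$, $\nu>0$. Suppose $x^*$ is the minimizer of $f$ over $\mathcal S$, and define $\mathcal S'=\mathcal S\cap\{x\in\mathbb{S}^{d-1}:\theta(x,x^* )\in(0,\pi/2)\}$. (i) If there is $L_1>0$ such that $\|\nabla^Rf(x)\|_2\le L_1$ for all $x\in\mathcal S$, then $f$ is $(\mu,2)$-RGA on $(\mathcal S',x^* )$ with $\mu=\nu/(2L_1)$. (ii) If there is $L_2>0$ such that $\|\nabla^Rf(x)\|_2\le L_2\|x-x^*\|_2$ for all $x\in\mathcal S$, then $f$ is $(\mu,1)$-RGA on $(\mathcal S',x^* )$ with $\mu=\nu/(4L_2)$.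
   Context: $\mathbb{S}^{d-1}$ is the unit sphere of $\mathbb{R}^d$; $\theta(x,y)=\arccos(x\cdot y)$ is the angle, equal to the geodesic distance. $\nabla^Rf(x)\perp x$ is the Riemannian gradient. A set $\mathcal S\subset\mathbb{S}^{d-1}$ is geodesically convex if it contains the minimizing geodesic between every pair of its points; $f$ is $\nu$-strongly geodesically convex on $\mathcal S$ if for every geodesic $\mathcal G_{x,y}(t)$, $t\in[0,1]$, in $\mathcal S$ from $x$ to $y$, $f(\mathcal G_{x,y}(t))+\frac\nu2t(1-t)\theta(x,y)^2\le(1-t)f(x)+tf(y)$ for all $t\in[0,1]$. $f$ is $(\mu,r)$-RGA on $(\mathcal X,x^* )$ if for every $x\in\mathcal X$: $\nabla^Rf(x)\neq0$ whenever $x\neq x^*$, and $\nabla^Rf(x)\cdot x^*\le-\mu\,\sin^r(\theta(x,x^* ))\,\|\nabla^Rf(x)\|_2$. *)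

theory Defs
  imports "HOL-Analysis.Analysis"
begin

definition sphere_angle :: "'a::real_inner \<Rightarrow> 'a \<Rightarrow> real" where
  "sphere_angle x y = arccos (x \<bullet> y)"

(* The constant-speed great-circle arcs t |-> exp_x (t w), 0 <= t <= 1, with initial velocity w
   tangent to the unit sphere at x.  The length l = norm w is arbitrary; the arc is minimizing
   iff l = sphere_angle x y.  Since sgn 0 = 0, the case w = 0 is the constant curve. *)
definition sphere_geodesic :: "(real \<Rightarrow> 'a::real_inner) \<Rightarrow> real \<Rightarrow> 'a \<Rightarrow> 'a \<Rightarrow> bool" where
  "sphere_geodesic \<gamma> l x y \<longleftrightarrow> norm x = 1 \<and> \<gamma> 1 = y \<and>
     (\<exists>w. w \<bullet> x = 0 \<and> norm w = l \<and>
        (\<forall>t\<in>{0..1}. \<gamma> t = cos (l * t) *\<^sub>R x + sin (l * t) *\<^sub>R sgn w))"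

definition minimizing_sphere_geodesic :: "(real \<Rightarrow> 'a::real_inner) \<Rightarrow> 'a \<Rightarrow> 'a \<Rightarrow> bool" where
  "minimizing_sphere_geodesic \<gamma> x y \<longleftrightarrow> sphere_geodesic \<gamma> (sphere_angle x y) x y"

(* Minimizing geodesics are unique except between antipodal points, where one of them is
   required to stay in S. *)
definition geodesically_convex :: "'a::real_inner set \<Rightarrow> bool" where
  "geodesically_convex S \<longleftrightarrow> S \<subseteq> sphere 0 1 \<and>
     (\<forall>x\<in>S. \<forall>y\<in>S. \<exists>\<gamma>. minimizing_sphere_geodesic \<gamma> x y \<and> \<gamma> ` {0..1} \<subseteq> S)"

definition strongly_geodesically_convex_on ::
  "real \<Rightarrow> 'a::real_inner set \<Rightarrow> ('a \<Rightarrow> real) \<Rightarrow> bool" where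
  "strongly_geodesically_convex_on \<nu> S f \<longleftrightarrow>
     (\<forall>\<gamma> l x y. sphere_geodesic \<gamma> l x y \<and> \<gamma> ` {0..1} \<subseteq> S \<longrightarrow>
        (\<forall>t\<in>{0..1}. f (\<gamma> t) + \<nu> / 2 * t * (1 - t) * (sphere_angle x y)\<^sup>2
                      \<le> (1 - t) * f x + t * f y))"

(* f, regarded as a function on the subset S of the sphere, is differentiable at x with
   Riemannian gradient g: a tangent vector with f y = f x + g . (y - x) + o(norm (y - x)) for
   y in S.  Only the values of f on S matter.  The tangent vector g is unique when x is
   interior to S in the sphere, but need not be for thin S; hence a relation, not a function. *)
definition has_riemannian_gradient ::
  "('a::real_inner \<Rightarrow> real) \<Rightarrow> 'a \<Rightarrow> 'a \<Rightarrow> 'a set \<Rightarrow> bool" where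
  "has_riemannian_gradient f g x S \<longleftrightarrow>
     g \<bullet> x = 0 \<and> (f has_derivative (\<lambda>h. g \<bullet> h)) (at x within S)"

(* f is (\<mu>, r)-RGA on (X, xs), where gradf is the Riemannian gradient of f. *)
definition RGA ::
  "real \<Rightarrow> nat \<Rightarrow> ('a::real_inner \<Rightarrow> real) \<Rightarrow> ('a \<Rightarrow> 'a) \<Rightarrow> 'a set \<Rightarrow> 'a \<Rightarrow> bool" where
  "RGA \<mu> r f gradf X xs \<longleftrightarrow>
     (\<forall>x\<in>X. has_riemannian_gradient f (gradf x) x X \<and>
        (x \<noteq> xs \<longrightarrow> gradf x \<noteq> 0) \<and>
        gradf x \<bullet> xs \<le> - \<mu> * sin (sphere_angle x xs) ^ r * norm (gradf x))"

end

theory Submission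
  imports Defs
begin

text \<open>
  Let \<open>x\<close> be a point of \<open>S'\<close>, at angle \<open>\<theta>\<close> from the minimizer \<open>xs\<close>, and let \<open>w\<close> be the initial
  velocity of the minimizing geodesic in \<open>S\<close> from \<open>x\<close> to \<open>xs\<close>.  Dividing the strong convexity
  inequality at time \<open>t\<close> by \<open>t\<close> and letting \<open>t \<rightarrow> 0\<close> gives the first-order inequality
  \<open>gradf x \<bullet> w \<le> f xs - f x - \<nu> / 2 * \<theta>\<^sup>2\<close> (\<open>strongly_geodesically_convex_gradient_le\<close>),
  and \<open>f xs \<le> f x\<close>.  Since \<open>xs = cos \<theta> *\<^sub>R x + sin \<theta> *\<^sub>R (w /\<^sub>R \<theta>)\<close> and the gradient is orthogonal
  to \<open>x\<close>, this becomes \<open>gradf x \<bullet> xs \<le> - \<nu> / 2 * \<theta> * sin \<theta>\<close> (\<open>gradient_inner_minimizer_le\<close>).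
  In particular the gradient does not vanish.  The two bounds then follow from \<open>sin \<theta> \<le> \<theta>\<close> and from
  the fact that the chord \<open>norm (x - xs)\<close> is at most the arc \<open>\<theta>\<close> (\<open>sphere_chord_le_angle\<close>).
\<close>

lemma right_derivative_nonpos:
  fixes \<psi> :: "real \<Rightarrow> real"
  assumes "(\<psi> has_field_derivative D) (at 0 within {0..1})"
    and "\<And>t. t \<in> {0..1} \<Longrightarrow> \<psi> t \<le> \<psi> 0"
  shows "D \<le> 0"
proof (rule tendsto_upperbound)
  show "((\<lambda>t. (\<psi> t - \<psi> 0) / (t - 0)) \<longlongrightarrow> D) (at 0 within {0..1})"
    using assms(1) by (simp add: has_field_derivative_iff)
  show "\<forall>\<^sub>F t in at 0 within {0..1}. (\<psi> t - \<psi> 0) / (t - 0) \<le> 0"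
    using assms(2) by (auto simp: eventually_at_filter divide_le_0_iff intro!: always_eventually)
  show "at (0::real) within {0..1} \<noteq> bot"
    by (simp add: trivial_limit_within)
qed

text \<open>
  The hypothesis on the arc is the unfolded form of \<^const>\<open>sphere_geodesic\<close> with length \<open>norm w\<close>,
  which makes the initial velocity \<open>w\<close> available.
\<close>
lemma strongly_geodesically_convex_gradient_le:
  fixes S :: "'a::real_inner set"
  assumes f: "strongly_geodesically_convex_on \<nu> S f"
    and g: "has_riemannian_gradient f g x S"
    and x: "norm x = 1" and w: "w \<bullet> x = 0"
    and \<gamma>: "\<And>t. t \<in> {0..1} \<Longrightarrow> \<gamma> t = cos (norm w * t) *\<^sub>R x + sin (norm w * t) *\<^sub>R sgn w"
    and S: "\<gamma> ` {0..1} \<subseteq> S"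
  shows "g \<bullet> w \<le> f (\<gamma> 1) - f x - \<nu> / 2 * (sphere_angle x (\<gamma> 1))\<^sup>2"
proof -
  define \<theta> where "\<theta> = sphere_angle x (\<gamma> 1)"
  define c where "c t = cos (norm w * t) *\<^sub>R x + sin (norm w * t) *\<^sub>R sgn w" for t
  \<comment> \<open>Strong convexity says \<open>\<psi> \<le> 0 = \<psi> 0\<close> on \<open>{0..1}\<close>; its right derivative at \<open>0\<close> carries the claim.\<close>
  define \<psi> where "\<psi> t = f (c t) + \<nu> / 2 * t * (1 - t) * \<theta>\<^sup>2 - ((1 - t) * f x + t * f (\<gamma> 1))" for t
  have c_S: "c ` {0..1} \<subseteq> S"
    using S \<gamma> by (force simp: c_def)
  have "(c has_vector_derivative norm w *\<^sub>R sgn w) (at 0 within {0..1})"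
    unfolding c_def by (auto intro!: derivative_eq_intros)
  moreover have "norm w *\<^sub>R sgn w = w"
    by (cases "w = 0") (simp_all add: sgn_div_norm)
  ultimately have "(c has_derivative (\<lambda>h. h *\<^sub>R w)) (at 0 within {0..1})"
    by (simp add: has_vector_derivative_def)
  moreover have "(f has_derivative (\<lambda>h. g \<bullet> h)) (at (c 0) within c ` {0..1})"
    using g c_S by (auto simp: has_riemannian_gradient_def c_def intro: has_derivative_subset)
  ultimately have "((\<lambda>t. f (c t)) has_derivative (\<lambda>h. g \<bullet> (h *\<^sub>R w))) (at 0 within {0..1})"
    using has_derivative_in_compose by blast
  then have "((\<lambda>t. f (c t)) has_field_derivative g \<bullet> w) (at 0 within {0..1})"
    by (simp add: has_field_derivative_def mult_commute_abs)
  then have "(\<psi> has_field_derivative g \<bullet> w + \<nu> / 2 * \<theta>\<^sup>2 - (f (\<gamma> 1) - f x)) (at 0 within {0..1})"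
    unfolding \<psi>_def by (auto intro!: derivative_eq_intros)
  moreover have "\<psi> t \<le> \<psi> 0" if t: "t \<in> {0..1}" for t
  proof -
    have "sphere_geodesic \<gamma> (norm w) x (\<gamma> 1)"
      unfolding sphere_geodesic_def using x w \<gamma> by blast
    then have "f (\<gamma> t) + \<nu> / 2 * t * (1 - t) * \<theta>\<^sup>2 \<le> (1 - t) * f x + t * f (\<gamma> 1)"
      using f S t unfolding strongly_geodesically_convex_on_def \<theta>_def by blast
    then show ?thesis
      using \<gamma>[OF t] by (simp add: \<psi>_def c_def)
  qed
  ultimately have "g \<bullet> w + \<nu> / 2 * \<theta>\<^sup>2 - (f (\<gamma> 1) - f x) \<le> 0"
    by (rule right_derivative_nonpos)
  then show ?thesis
    by (simp add: \<theta>_def)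
qed

lemma gradient_inner_minimizer_le:
  fixes S :: "'a::real_inner set"
  assumes S: "geodesically_convex S"
    and f: "strongly_geodesically_convex_on \<nu> S f"
    and g: "has_riemannian_gradient f g x S"
    and xs: "is_arg_min f (\<lambda>x. x \<in> S) xs"
    and x: "x \<in> S" and angle: "0 < sphere_angle x xs" "sphere_angle x xs \<le> pi"
  shows "g \<bullet> xs \<le> - \<nu> / 2 * sphere_angle x xs * sin (sphere_angle x xs)"
proof -
  define \<theta> where "\<theta> = sphere_angle x xs"
  have "xs \<in> S" "f xs \<le> f x"
    using xs x by (auto simp: is_arg_min_def not_less)
  then obtain \<gamma> where "minimizing_sphere_geodesic \<gamma> x xs" and \<gamma>S: "\<gamma> ` {0..1} \<subseteq> S"
    using S x unfolding geodesically_convex_def by blast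
  then have "sphere_geodesic \<gamma> \<theta> x xs"
    by (simp add: minimizing_sphere_geodesic_def \<theta>_def)
  then obtain w where nx: "norm x = 1" and \<gamma>1: "\<gamma> 1 = xs" and w: "w \<bullet> x = 0" "norm w = \<theta>"
    and "\<forall>t\<in>{0..1}. \<gamma> t = cos (\<theta> * t) *\<^sub>R x + sin (\<theta> * t) *\<^sub>R sgn w"
    unfolding sphere_geodesic_def by (elim conjE exE)
  then have \<gamma>: "\<gamma> t = cos (norm w * t) *\<^sub>R x + sin (norm w * t) *\<^sub>R sgn w" if "t \<in> {0..1}" for t
    using that by simp
  have "g \<bullet> w \<le> - \<nu> / 2 * \<theta>\<^sup>2"
    using strongly_geodesically_convex_gradient_le[OF f g nx w(1) \<gamma> \<gamma>S] \<open>f xs \<le> f x\<close>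
    by (simp add: \<gamma>1 \<theta>_def)
  then have gw: "g \<bullet> sgn w \<le> - \<nu> / 2 * \<theta>"
    using angle w(2) by (simp add: sgn_div_norm \<theta>_def power2_eq_square field_simps)
  have "xs = cos \<theta> *\<^sub>R x + sin \<theta> *\<^sub>R sgn w"
    using \<gamma>[of 1] \<gamma>1 w(2) by simp
  moreover have "g \<bullet> x = 0"
    using g by (simp add: has_riemannian_gradient_def)
  ultimately have "g \<bullet> xs = sin \<theta> * (g \<bullet> sgn w)"
    by (simp add: inner_add_right)
  also have "\<dots> \<le> sin \<theta> * (- \<nu> / 2 * \<theta>)"
    using gw angle by (intro mult_left_mono sin_ge_zero) (auto simp: \<theta>_def)
  finally show ?thesis
    by (simp add: \<theta>_def mult_ac)
qed

lemma sphere_chord_le_angle: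
  fixes x y :: "'a::real_inner"
  assumes "norm x = 1" "norm y = 1"
  shows "norm (x - y) \<le> sphere_angle x y"
proof -
  define \<theta> where "\<theta> = sphere_angle x y"
  have "\<bar>x \<bullet> y\<bar> \<le> 1"
    using Cauchy_Schwarz_ineq2[of x y] assms by simp
  then have \<theta>: "cos \<theta> = x \<bullet> y" "0 \<le> \<theta>"
    by (auto simp: \<theta>_def sphere_angle_def cos_arccos_abs intro!: arccos_lbound)
  have "(norm (x - y))\<^sup>2 = 2 - 2 * cos \<theta>"
    using assms \<theta> by (simp add: norm_eq_1 power2_norm_eq_inner inner_diff inner_commute)
  also have "\<dots> = (2 * sin (\<theta> / 2))\<^sup>2"
    using cos_double_sin[of "\<theta> / 2"] by (simp add: power_mult_distrib)
  also have "\<dots> \<le> \<theta>\<^sup>2"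
    using abs_sin_x_le_abs_x[of "\<theta> / 2"] \<theta>(2) by (intro power2_le_iff_abs_le[THEN iffD2]) (auto simp: abs_mult)
  finally show ?thesis
    using \<theta>(2) power2_le_imp_le unfolding \<theta>_def by blast
qed

theorem lemmaB1:
  fixes S S' :: "(real ^ 'd) set"
    and f :: "real ^ 'd \<Rightarrow> real"
    and gradf :: "real ^ 'd \<Rightarrow> real ^ 'd"
    and xs :: "real ^ 'd"
    and \<nu> :: real
  assumes "S \<subseteq> sphere 0 1"
    and "geodesically_convex S"
    and "\<forall>x\<in>S. has_riemannian_gradient f (gradf x) x S"
    and "\<nu> > 0"
    and "strongly_geodesically_convex_on \<nu> S f"
    and "is_arg_min f (\<lambda>x. x \<in> S) xs"
    and "S' = S \<inter> {x \<in> sphere 0 1. sphere_angle x xs \<in> {0<..<pi / 2}}"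
  shows "(\<forall>L1>0. (\<forall>x\<in>S. norm (gradf x) \<le> L1) \<longrightarrow>
            RGA (\<nu> / (2 * L1)) 2 f gradf S' xs) \<and>
         (\<forall>L2>0. (\<forall>x\<in>S. norm (gradf x) \<le> L2 * norm (x - xs)) \<longrightarrow>
            RGA (\<nu> / (4 * L2)) 1 f gradf S' xs)"
proof -
  let ?\<theta> = "\<lambda>x. sphere_angle x xs"
  have "xs \<in> S"
    using assms(6) by (simp add: is_arg_min_def)
  have \<theta>: "0 < ?\<theta> x" "0 < sin (?\<theta> x)" "sin (?\<theta> x) \<le> ?\<theta> x" if "x \<in> S'" for x
    using that assms(7) by (auto intro: sin_gt_zero sin_x_le_x)
  have grad: "gradf x \<bullet> xs \<le> - \<nu> / 2 * ?\<theta> x * sin (?\<theta> x)" if "x \<in> S'" for x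
    using that assms gradient_inner_minimizer_le[of S \<nu> f "gradf x" x xs] by auto
  have chord: "norm (x - xs) \<le> ?\<theta> x" if "x \<in> S'" for x
    using that assms(1,7) \<open>xs \<in> S\<close> by (intro sphere_chord_le_angle) auto
  have RGA_I: "RGA \<mu> r f gradf S' xs"
    if le: "\<And>x. x \<in> S' \<Longrightarrow> \<mu> * sin (?\<theta> x) ^ r * norm (gradf x) \<le> \<nu> / 2 * ?\<theta> x * sin (?\<theta> x)"
    for \<mu> r
    unfolding RGA_def
  proof (intro ballI conjI impI)
    fix x assume x: "x \<in> S'"
    show "has_riemannian_gradient f (gradf x) x S'"
      using x assms(3,7) by (auto simp: has_riemannian_gradient_def intro: has_derivative_subset)
    have "0 < \<nu> / 2 * ?\<theta> x * sin (?\<theta> x)"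
      using \<theta>[OF x] assms(4) by simp
    then show "gradf x \<noteq> 0"
      using grad[OF x] by auto
    show "gradf x \<bullet> xs \<le> - \<mu> * sin (?\<theta> x) ^ r * norm (gradf x)"
      using grad[OF x] le[OF x] by simp
  qed
  have "RGA (\<nu> / (2 * L)) 2 f gradf S' xs" if L: "L > 0" "\<forall>x\<in>S. norm (gradf x) \<le> L" for L
  proof (rule RGA_I)
    fix x assume x: "x \<in> S'"
    have "\<nu> / (2 * L) * (sin (?\<theta> x))\<^sup>2 * norm (gradf x) \<le> \<nu> / (2 * L) * (sin (?\<theta> x))\<^sup>2 * L"
      using L x assms(4,7) by (intro mult_left_mono) auto
    also have "\<dots> = \<nu> / 2 * sin (?\<theta> x) * sin (?\<theta> x)"
      using L by (simp add: power2_eq_square)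
    also have "\<dots> \<le> \<nu> / 2 * ?\<theta> x * sin (?\<theta> x)"
      using \<theta>[OF x] assms(4) by (intro mult_right_mono mult_left_mono) auto
    finally show "\<nu> / (2 * L) * (sin (?\<theta> x))\<^sup>2 * norm (gradf x) \<le> \<nu> / 2 * ?\<theta> x * sin (?\<theta> x)" .
  qed
  moreover have "RGA (\<nu> / (4 * L)) 1 f gradf S' xs"
    if L: "L > 0" "\<forall>x\<in>S. norm (gradf x) \<le> L * norm (x - xs)" for L
  proof (rule RGA_I)
    fix x assume x: "x \<in> S'"
    have "norm (gradf x) \<le> L * norm (x - xs)"
      using L x assms(7) by blast
    also have "\<dots> \<le> L * ?\<theta> x"
      using L chord[OF x] by simp
    finally have "\<nu> / (4 * L) * sin (?\<theta> x) ^ 1 * norm (gradf x)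
        \<le> \<nu> / (4 * L) * sin (?\<theta> x) ^ 1 * (L * ?\<theta> x)"
      using L \<theta>[OF x] assms(4) by (intro mult_left_mono) auto
    also have "\<dots> = \<nu> / 4 * ?\<theta> x * sin (?\<theta> x)"
      using L by simp
    also have "\<dots> \<le> \<nu> / 2 * ?\<theta> x * sin (?\<theta> x)"
      using \<theta>[OF x] assms(4) by (intro mult_right_mono) auto
    finally show "\<nu> / (4 * L) * sin (?\<theta> x) ^ 1 * norm (gradf x) \<le> \<nu> / 2 * ?\<theta> x * sin (?\<theta> x)" .
  qed
  ultimately show ?thesis
    by blast
qed

end
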